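(* Let $A$ and $B$ be Banach spaces, let $\Delta\subseteq A$ be a nonempty open convex set, and let $\pounds:\Delta\subseteq A\to B$ be a continuous nonlinear operator (not assumed to be differentiable), with a divided difference of order one $[\cdot,\cdot;\pounds]$ on $\Delta$. Let $a_0,b_0\in\Delta$ be initial points, put $\Upsilon_0=[a_0,b_0;\pounds]$ and assume that $\Upsilon_0$ is invertible. Let $s>0$, $\beta>0$, $\eta>0$, and let $\omega:\mathbb{R}_+\times\mathbb{R}_+\to\mathbb{R}_+$ be continuous and non-decreasing in both of its arguments. Assume that (A1) $\|a_0-b_0\|\le s$; (A2) $\|\Upsilon_0^{-1}\|\le\beta$; (A3) $\|\Upsilon_0^{-1}\pounds(a_0)\|\le\eta$; (A4) $\|[a,b;\pounds]-[u,v;\pounds]\|\le\omega(\|a-u\|,\|b-v\|)$ for all $a,b,u,v\in\Delta$. Let $m=\max\{\beta\,\omega(\eta,s),\ \beta\,\omega(\eta,\eta)\}$, and suppose that the equation $$\mu\left(1-\frac{m}{1-\beta\,\omega(\mu,s+3\mu)}\right)-\eta=0$$ in the unknown $\mu$ has at least one positive root; let $\rho$ denote its smallest positive root. Suppose further that $$\beta\,\omega(\rho,s+3\rho)<1,\qquad W:=\frac{m}{1-\beta\,\omega(\rho,s+3\rho)}<1,\qquad \overline{R(a_0,\rho)}\subset\Delta.$$ Then the sequences $\{a_k\}$ and $\{b_k\}$ generated from $a_0,b_0$ by the two-step Secant method $$a_{k+1}=a_k-\Upsilon_k^{-1}\pounds(a_k),\qquad b_{k+1}=a_{k+1}-\Upsilon_k^{-1}\pounds(a_{k+1}),\qquad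 \Upsilon_k=[a_k,b_k;\pounds],\qquad k=0,1,2,\dots,$$ both converge to a solution $a^*$ of $\pounds(a)=0$. Moreover, $a^*$ belongs to $R(a_0,\rho)$ and is the unique solution of $\pounds(a)=0$ in $\overline{R(a_0,\rho)}$.
   Context: A divided difference of order one for $\pounds$ on $\Delta$ is an assignment, to each pair $(a,b)\in\Delta\times\Delta$, of a bounded linear operator $[a,b;\pounds]\in L(A,B)$ such that $[a,b;\pounds](a-b)=\pounds(a)-\pounds(b)$ whenever $a\ne b$. Such an assignment is fixed throughout; $L(A,B)$ is the space of bounded linear operators from $A$ to $B$ with the operator norm. Invertible means having a bounded linear inverse in $L(B,A)$. $\mathbb{R}_+=[0,\infty)$. For $a_0\in A$ and $\rho>0$, $R(a_0,\rho)$ is the open ball in $A$ with center $a_0$ and radius $\rho$, and $\overline{R(a_0,\rho)}$ is its closure. *)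

theory Defs
  imports "HOL-Analysis.Analysis"
begin

definition is_blinfun_inverse ::
  "('a::real_normed_vector \<Rightarrow>\<^sub>L 'b::real_normed_vector) \<Rightarrow> ('b \<Rightarrow>\<^sub>L 'a) \<Rightarrow> bool"
  where "is_blinfun_inverse T S \<longleftrightarrow> S o\<^sub>L T = id_blinfun \<and> T o\<^sub>L S = id_blinfun"

definition blinfun_invertible ::
  "('a::real_normed_vector \<Rightarrow>\<^sub>L 'b::real_normed_vector) \<Rightarrow> bool"
  where "blinfun_invertible T \<longleftrightarrow> (\<exists>S. is_blinfun_inverse T S)"

text \<open>The inverse is unspecified when \<open>T\<close> is not invertible.\<close>

definition blinfun_inv ::
  "('a::real_normed_vector \<Rightarrow>\<^sub>L 'b::real_normed_vector) \<Rightarrow> ('b \<Rightarrow>\<^sub>L 'a)"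
  where "blinfun_inv T = (THE S. is_blinfun_inverse T S)"

definition divided_difference_on ::
  "'a::real_normed_vector set \<Rightarrow> ('a \<Rightarrow> 'b::real_normed_vector) \<Rightarrow> ('a \<Rightarrow> 'a \<Rightarrow> ('a \<Rightarrow>\<^sub>L 'b)) \<Rightarrow> bool"
  where "divided_difference_on D F dd \<longleftrightarrow>
    (\<forall>a\<in>D. \<forall>b\<in>D. a \<noteq> b \<longrightarrow> blinfun_apply (dd a b) (a - b) = F a - F b)"

text \<open>
  As usual for the equation \<open>F x = 0\<close>, nonlinear means that \<open>F\<close> is not of the form
  ``linear plus constant'' on its domain. This is needed for the solution to lie in the open ball:
  for \<open>F x = x\<close> on the real line with \<open>\<omega> = 0\<close>, \<open>\<beta> = 1\<close> and \<open>a\<^sub>0 = \<eta>\<close> one gets \<open>\<rho> = \<eta>\<close>,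
  and the solution \<open>0\<close> lies on the boundary.
\<close>

definition nonlinear_on ::
  "'a::real_vector set \<Rightarrow> ('a \<Rightarrow> 'b::real_vector) \<Rightarrow> bool"
  where "nonlinear_on D F \<longleftrightarrow> \<not> (\<exists>L c. linear L \<and> (\<forall>x\<in>D. F x = L x + c))"

text \<open>
  The nonvanishing of the denominator is explicit because of the convention \<open>x / 0 = 0\<close>, which
  would otherwise make \<open>\<mu> = \<eta>\<close> a spurious root.
\<close>

definition positive_root ::
  "(real \<Rightarrow> real \<Rightarrow> real) \<Rightarrow> real \<Rightarrow> real \<Rightarrow> real \<Rightarrow> real \<Rightarrow> real \<Rightarrow> bool"
  where "positive_root \<omega> \<beta> \<eta> s m \<mu> \<longleftrightarrow>
    \<mu> > 0 \<and> 1 - \<beta> * \<omega> \<mu> (s + 3 * \<mu>) \<noteq> 0 \<and>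
    \<mu> * (1 - m / (1 - \<beta> * \<omega> \<mu> (s + 3 * \<mu>))) - \<eta> = 0"

end

theory Submission
  imports Defs
begin

text \<open>
  Everything is measured after applying \<open>G = \<Upsilon>\<^sub>0\<^sup>-\<^sup>1\<close>. Write \<open>g = \<beta> \<omega>(\<rho>, s + 3\<rho>) < 1\<close>.
  A divided difference \<open>[p, q]\<close> with \<open>p\<close> within \<open>\<rho>\<close> of \<open>a\<^sub>0\<close> and \<open>q\<close> within \<open>s + \<rho>\<close> of \<open>b\<^sub>0\<close>
  satisfies \<open>\<parallel>G [p, q] - I\<parallel> \<le> g\<close>. Three things follow from this single estimate:
  such a divided difference is invertible and its inverse is at most \<open>1 / (1 - g)\<close> times as
  large as \<open>G\<close> (\<open>near_inverse_invertible\<close>, \<open>near_inverse_inverse_bound\<close>); \<open>F\<close> is expanding near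
  \<open>a\<^sub>0\<close>, in the sense \<open>(1 - g) \<parallel>p - q\<parallel> \<le> \<parallel>G (F p) - G (F q)\<parallel>\<close> (\<open>expanding\<close>), which gives uniqueness
  of the zero; and one step of the method multiplies the increments by at most \<open>W = m / (1 - g)\<close>.
  The last point rests on the identity
  \<open>F a\<^bsub>k+1\<^esub> = ([a\<^bsub>k+1\<^esub>, a\<^sub>k] - [a\<^sub>k, b\<^sub>k]) (a\<^bsub>k+1\<^esub> - a\<^sub>k)\<close>, which expresses the new residual through
  the variation of the divided difference (\<open>residual_bound\<close>), so that it is at most
  \<open>m \<parallel>a\<^bsub>k+1\<^esub> - a\<^sub>k\<parallel>\<close> after applying \<open>G\<close>.
  The increments are thus dominated by \<open>\<eta> W\<^sup>k\<close>, whose sum is \<open>\<eta> / (1 - W) = \<rho>\<close> because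
  \<open>\<rho>\<close> is a root of the given equation: the points \<open>a\<^sub>k\<close> stay in the closed ball and form a
  Cauchy sequence (\<open>iterate_bounds\<close>).

  Summing the geometric series only places the limit in the closed ball. For the open ball, the expansion
  estimate is applied to \<open>a\<^sup>*\<close> and \<open>a\<^sub>1\<close>: since \<open>\<parallel>G (F a\<^sub>1)\<parallel> \<le> m \<eta>\<close>, it gives
  \<open>\<parallel>a\<^sup>* - a\<^sub>1\<parallel> \<le> W \<eta>\<close>, hence \<open>\<parallel>a\<^sup>* - a\<^sub>0\<parallel> \<le> (1 + W) \<eta> = \<rho> (1 - W\<^sup>2)\<close>, which is smaller than \<open>\<rho>\<close> as soon as
  \<open>W > 0\<close>. The case \<open>W = 0\<close> is where nonlinearity enters: then \<open>m = 0\<close>,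
  so \<open>\<omega>(\<eta>, \<eta>) = 0\<close>, the operators \<open>[x, a\<^sub>0]\<close> are locally constant in \<open>x\<close> on the connected set
  \<open>\<Delta>\<close>, hence constant, and \<open>F\<close> is linear plus constant (\<open>rigid_divided_difference_not_nonlinear\<close>).
\<close>

section \<open>Inverses of bounded linear operators\<close>

lemma is_blinfun_inverse_iff:
  "is_blinfun_inverse T S \<longleftrightarrow> (\<forall>x. S (T x) = x) \<and> (\<forall>y. T (S y) = y)"
  unfolding is_blinfun_inverse_def
  by (metis blinfun_apply_blinfun_compose blinfun_apply_id_blinfun blinfun_eqI id_apply)

lemma is_blinfun_inverse_unique:
  assumes "is_blinfun_inverse T S" "is_blinfun_inverse T S'"
  shows "S = S'"
  using assms unfolding is_blinfun_inverse_iff by (metis blinfun_eqI)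

lemma is_blinfun_inverse_blinfun_inv:
  assumes "blinfun_invertible T"
  shows "is_blinfun_inverse T (blinfun_inv T)"
  using assms unfolding blinfun_invertible_def blinfun_inv_def
  by (metis is_blinfun_inverse_unique theI)

lemma blinfun_inv_right: "blinfun_invertible T \<Longrightarrow> T (blinfun_inv T y) = y"
  using is_blinfun_inverse_blinfun_inv is_blinfun_inverse_iff by blast

text \<open>
  If \<open>G\<close> is a left inverse of \<open>T\<close> up to a relative error \<open>g < 1\<close>, then \<open>G T\<close> cannot shrink vectors by
  more than the factor \<open>1 - g\<close>. With \<open>x = T\<^sup>-\<^sup>1 y\<close> this bounds \<open>T\<^sup>-\<^sup>1\<close>; with \<open>T = [p, q]\<close> and
  \<open>x = p - q\<close> it makes \<open>F\<close> expanding.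
\<close>

lemma near_inverse_lower_bound:
  fixes T :: "'a::real_normed_vector \<Rightarrow>\<^sub>L 'b::real_normed_vector"
    and G :: "'b \<Rightarrow>\<^sub>L 'a"
  assumes "norm (G (T x) - x) \<le> g * norm x"
  shows "(1 - g) * norm x \<le> norm (G (T x))"
proof -
  have "norm x \<le> norm (G (T x)) + norm (G (T x) - x)"
    by (metis norm_minus_commute norm_triangle_sub)
  with assms show ?thesis by (simp add: algebra_simps)
qed

text \<open>
  For injective \<open>G\<close>, solving \<open>T x = y\<close> amounts to finding a fixed point of \<open>x \<mapsto> x - G (T x) + G y\<close>,
  which is a contraction; so Banach's fixed point theorem provides the inverse, and the
  lower bound makes it continuous.
\<close>

lemma near_inverse_invertible:
  fixes T :: "'a::banach \<Rightarrow>\<^sub>L 'b::real_normed_vector"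
    and G :: "'b \<Rightarrow>\<^sub>L 'a"
  assumes inj: "\<And>y. G y = 0 \<Longrightarrow> y = 0"
    and near: "\<And>x. norm (G (T x) - x) \<le> g * norm x"
    and "0 \<le> g" "g < 1"
  shows "blinfun_invertible T"
proof -
  have "\<exists>!x. T x = y" for y
  proof -
    let ?f = "\<lambda>x. x - G (T x) + G y"
    have "?f x - ?f x' = - (G (T (x - x')) - (x - x'))" for x x'
      by (simp add: blinfun.diff_right)
    then have "dist (?f x) (?f x') \<le> g * dist x x'" for x x'
      using near[of "x - x'"] unfolding dist_norm by (metis norm_minus_cancel)
    then have "\<exists>!x. ?f x = x"
      using \<open>0 \<le> g\<close> \<open>g < 1\<close> by (intro banach_fix_type[of g]) auto
    moreover have "?f x = x \<longleftrightarrow> T x = y" for x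
    proof -
      have "?f x = x \<longleftrightarrow> G (T x - y) = 0"
        by (auto simp: blinfun.diff_right algebra_simps)
      also have "\<dots> \<longleftrightarrow> T x = y" using inj by fastforce
      finally show ?thesis .
    qed
    ultimately show ?thesis by simp
  qed
  then obtain h where h: "\<And>y. T (h y) = y" and uniq: "\<And>x y. T x = y \<Longrightarrow> x = h y"
    by metis
  have "bounded_linear h"
  proof (rule bounded_linear_intro)
    show "h (x + y) = h x + h y" for x y
      by (rule uniq[symmetric]) (simp add: blinfun.add_right h)
    show "h (r *\<^sub>R x) = r *\<^sub>R h x" for r x
      by (rule uniq[symmetric]) (simp add: blinfun.scaleR_right h)
    show "norm (h y) \<le> norm y * (norm G / (1 - g))" for y
    proof -
      have "(1 - g) * norm (h y) \<le> norm (G y)"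
        using near_inverse_lower_bound[OF near, of "h y"] by (simp add: h)
      also have "\<dots> \<le> norm G * norm y" by (rule norm_blinfun)
      finally show ?thesis using \<open>g < 1\<close> by (simp add: field_simps)
    qed
  qed
  then have "is_blinfun_inverse T (Blinfun h)"
    unfolding is_blinfun_inverse_iff using h uniq by (metis bounded_linear_Blinfun_apply)
  then show ?thesis unfolding blinfun_invertible_def by blast
qed

lemma near_inverse_inverse_bound:
  fixes T :: "'a::real_normed_vector \<Rightarrow>\<^sub>L 'b::real_normed_vector"
    and G :: "'b \<Rightarrow>\<^sub>L 'a"
  assumes "\<And>x. norm (G (T x) - x) \<le> g * norm x" "blinfun_invertible T"
  shows "(1 - g) * norm (blinfun_inv T y) \<le> norm (G y)"
  using near_inverse_lower_bound[OF assms(1), of "blinfun_inv T y"] assms(2)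
  by (simp add: blinfun_inv_right)

section \<open>Locally constant divided differences\<close>

lemma locally_constant_on_convex:
  fixes f :: "'a::real_normed_vector \<Rightarrow> 'c"
  assumes "convex D" "0 < \<eta>"
    and loc: "\<And>x y. x \<in> D \<Longrightarrow> y \<in> D \<Longrightarrow> norm (x - y) \<le> \<eta> \<Longrightarrow> f x = f y"
    and "x \<in> D" "y \<in> D"
  shows "f x = f y"
proof (rule connected_local_const[OF convex_connected[OF \<open>convex D\<close>] \<open>x \<in> D\<close> \<open>y \<in> D\<close>], rule ballI)
  fix u assume "u \<in> D"
  show "eventually (\<lambda>v. f u = f v) (at u within D)"
    unfolding eventually_at using \<open>0 < \<eta>\<close> loc[OF \<open>u \<in> D\<close>]
    by (intro exI[of _ \<eta>]) (auto simp: dist_norm norm_minus_commute)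
qed

text \<open>
  With the second argument held at \<open>c\<close>, moving the first through the connected set \<open>D\<close> shows that
  \<open>[x, c]\<close> is one operator for all \<open>x\<close>, so \<open>F x - F c = [x, c] (x - c)\<close> is linear in \<open>x - c\<close>.
\<close>

lemma rigid_divided_difference_not_nonlinear:
  fixes F :: "'a::real_normed_vector \<Rightarrow> 'b::real_normed_vector"
  assumes "convex D" "0 < \<eta>" "divided_difference_on D F dd" "c \<in> D"
    and rigid: "\<And>p u. p \<in> D \<Longrightarrow> u \<in> D \<Longrightarrow> norm (p - u) \<le> \<eta> \<Longrightarrow> dd p c = dd u c"
  shows "\<not> nonlinear_on D F"
proof -
  have "F x = dd c c x + (F c - dd c c c)" if "x \<in> D" for x
  proof (cases "x = c")
    case False
    then have "dd x c (x - c) = F x - F c"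
      using assms(3,4) that unfolding divided_difference_on_def by blast
    moreover have "dd x c = dd c c"
      using locally_constant_on_convex[of D \<eta> "\<lambda>p. dd p c"] assms(1,2) rigid that \<open>c \<in> D\<close> by blast
    ultimately show ?thesis by (simp add: blinfun.diff_right algebra_simps)
  qed simp
  moreover have "linear (dd c c)"
    using blinfun.bounded_linear_right bounded_linear.linear by blast
  ultimately show ?thesis unfolding nonlinear_on_def by blast
qed

section \<open>Convergence of the two-step Secant method\<close>

text \<open>
  The assumptions separate the convergence argument from the scalar equation: \<open>g\<close> bounds the
  perturbation of \<open>\<Upsilon>\<^sub>0\<close> over the ball and \<open>m\<close> the perturbation over one step. The scalar equation
  for \<open>\<rho>\<close> enters only as \<open>\<rho> (1 - W) = \<eta>\<close>, the sum of a geometric series.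
\<close>

locale secant_iteration =
  fixes \<Delta> :: "'a::banach set"
    and F :: "'a \<Rightarrow> 'b::banach"
    and dd :: "'a \<Rightarrow> 'a \<Rightarrow> ('a \<Rightarrow>\<^sub>L 'b)"
    and G :: "'b \<Rightarrow>\<^sub>L 'a"
    and a b :: "nat \<Rightarrow> 'a"
    and s \<beta> \<eta> m g \<rho> W :: real
    and \<omega> :: "real \<Rightarrow> real \<Rightarrow> real"
  assumes F_cont: "continuous_on \<Delta> F"
    and dd: "divided_difference_on \<Delta> F dd"
    and a0: "a 0 \<in> \<Delta>" and b0: "b 0 \<in> \<Delta>"
    and G: "is_blinfun_inverse (dd (a 0) (b 0)) G"
    and \<beta>: "\<beta> > 0" and \<eta>: "\<eta> > 0" and \<rho>: "\<rho> > 0"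
    and \<omega>_nonneg: "\<And>x y. x \<ge> 0 \<Longrightarrow> y \<ge> 0 \<Longrightarrow> \<omega> x y \<ge> 0"
    and \<omega>_mono: "\<And>x x' y y'. 0 \<le> x \<Longrightarrow> x \<le> x' \<Longrightarrow> 0 \<le> y \<Longrightarrow> y \<le> y' \<Longrightarrow> \<omega> x y \<le> \<omega> x' y'"
    and A1: "norm (a 0 - b 0) \<le> s"
    and A2: "norm G \<le> \<beta>"
    and A3: "norm (G (F (a 0))) \<le> \<eta>"
    and A4: "\<And>p q u v. p \<in> \<Delta> \<Longrightarrow> q \<in> \<Delta> \<Longrightarrow> u \<in> \<Delta> \<Longrightarrow> v \<in> \<Delta> \<Longrightarrow>
               norm (dd p q - dd u v) \<le> \<omega> (norm (p - u)) (norm (q - v))"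
    and m_s: "\<beta> * \<omega> \<eta> s \<le> m" and m_\<eta>: "\<beta> * \<omega> \<eta> \<eta> \<le> m"
    and g: "\<beta> * \<omega> \<rho> (s + \<rho>) \<le> g" and g1: "g < 1"
    and gW: "(1 - g) * W = m" and W1: "W < 1" and \<rho>W: "\<rho> * (1 - W) = \<eta>"
    and ball: "cball (a 0) \<rho> \<subseteq> \<Delta>"
    and step_a: "\<And>k. a (Suc k) = a k - blinfun_inv (dd (a k) (b k)) (F (a k))"
    and step_b: "\<And>k. b (Suc k) = a (Suc k) - blinfun_inv (dd (a k) (b k)) (F (a (Suc k)))"
begin

lemma s_nonneg: "0 \<le> s" using A1 norm_ge_zero order_trans by blast

lemma g_nonneg: "0 \<le> g"
  using \<beta> \<rho> s_nonneg by (intro order_trans[OF _ g] mult_nonneg_nonneg \<omega>_nonneg) auto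

lemma m_nonneg: "0 \<le> m"
  using \<beta> \<eta> by (intro order_trans[OF _ m_\<eta>] mult_nonneg_nonneg \<omega>_nonneg) auto

lemma W_nonneg: "0 \<le> W"
proof (rule ccontr)
  assume "\<not> 0 \<le> W"
  then have "(1 - g) * W < 0" using g1 by (simp add: mult_pos_neg)
  with gW m_nonneg show False by simp
qed

lemma in_\<Delta>: "norm (p - a 0) \<le> \<rho> \<Longrightarrow> p \<in> \<Delta>"
  using ball by (auto simp: dist_norm norm_minus_commute)

lemma G_left: "G (dd (a 0) (b 0) x) = x" and G_right: "dd (a 0) (b 0) (G y) = y"
  using G unfolding is_blinfun_inverse_iff by auto

lemma G_inj: "G y = 0 \<Longrightarrow> y = 0"
  using G_right[of y] by (simp add: blinfun.zero_right)

lemma F_diff: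
  assumes "p \<in> \<Delta>" "q \<in> \<Delta>"
  shows "F p - F q = dd p q (p - q)"
  using dd assms unfolding divided_difference_on_def
  by (cases "p = q") (auto simp: blinfun.zero_right)

lemma G_dd_diff_bound:
  assumes "p \<in> \<Delta>" "q \<in> \<Delta>" "u \<in> \<Delta>" "v \<in> \<Delta>"
    and "norm (p - u) \<le> c" "norm (q - v) \<le> d"
  shows "norm (G ((dd p q - dd u v) x)) \<le> \<beta> * \<omega> c d * norm x"
proof -
  have "norm (dd p q - dd u v) \<le> \<omega> (norm (p - u)) (norm (q - v))" using A4 assms by blast
  also have "\<dots> \<le> \<omega> c d" using assms by (intro \<omega>_mono) auto
  finally have le: "norm (dd p q - dd u v) \<le> \<omega> c d" .
  have "norm (G ((dd p q - dd u v) x)) \<le> norm G * norm ((dd p q - dd u v) x)"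
    by (rule norm_blinfun)
  also have "\<dots> \<le> \<beta> * (\<omega> c d * norm x)"
  proof (rule mult_mono)
    show "norm ((dd p q - dd u v) x) \<le> \<omega> c d * norm x"
      using norm_blinfun[of "dd p q - dd u v" x] mult_right_mono[OF le, of "norm x"] by simp
  qed (use A2 \<beta> in auto)
  finally show ?thesis by simp
qed

lemma dd_near_inverse:
  assumes "q \<in> \<Delta>" "norm (p - a 0) \<le> \<rho>" "norm (q - b 0) \<le> s + \<rho>"
  shows "norm (G (dd p q x) - x) \<le> g * norm x"
proof -
  have "G (dd p q x) - x = G ((dd p q - dd (a 0) (b 0)) x)"
    by (simp add: blinfun.diff_left blinfun.diff_right G_left)
  also have "norm \<dots> \<le> \<beta> * \<omega> \<rho> (s + \<rho>) * norm x"
    using assms in_\<Delta> a0 b0 by (intro G_dd_diff_bound) auto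
  also have "\<dots> \<le> g * norm x" using g by (intro mult_right_mono) auto
  finally show ?thesis .
qed

lemma near_b0:
  assumes "norm (q - a 0) \<le> \<rho>"
  shows "norm (q - b 0) \<le> s + \<rho>"
  using norm_triangle_ineq[of "q - a 0" "a 0 - b 0"] assms A1 by simp

lemma expanding:
  assumes "norm (p - a 0) \<le> \<rho>" "norm (q - a 0) \<le> \<rho>"
  shows "(1 - g) * norm (p - q) \<le> norm (G (F p) - G (F q))"
proof -
  have "(1 - g) * norm (p - q) \<le> norm (G (dd p q (p - q)))"
    using assms by (intro near_inverse_lower_bound dd_near_inverse in_\<Delta> near_b0)
  also have "dd p q (p - q) = F p - F q" using F_diff assms in_\<Delta> by metis
  finally show ?thesis by (simp add: blinfun.diff_right)
qed

text \<open>
  The step is chosen so that \<open>F a\<^sub>k + [a\<^sub>k, b\<^sub>k] (a\<^bsub>k+1\<^esub> - a\<^sub>k) = 0\<close>. Subtracting this from \<open>F a\<^bsub>k+1\<^esub>\<close>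
  leaves only the difference of two divided differences applied to the increment.
\<close>

lemma residual_bound:
  assumes inv: "blinfun_invertible (dd (a k) (b k))"
    and \<Delta>: "a k \<in> \<Delta>" "b k \<in> \<Delta>" "a (Suc k) \<in> \<Delta>"
    and inc: "norm (a (Suc k) - a k) \<le> \<eta>"
    and gap: "norm (b k - a k) \<le> s \<or> norm (b k - a k) \<le> \<eta>"
  shows "norm (G (F (a (Suc k)))) \<le> m * norm (a (Suc k) - a k)"
proof -
  let ?u = "a (Suc k) - a k"
  obtain d where d: "norm (a k - b k) \<le> d" "\<beta> * \<omega> \<eta> d \<le> m"
    using gap m_s m_\<eta> by (metis norm_minus_commute)
  have "dd (a k) (b k) ?u = - F (a k)"
    using inv by (simp add: step_a blinfun.minus_right blinfun_inv_right)
  then have "F (a (Suc k)) = (dd (a (Suc k)) (a k) - dd (a k) (b k)) ?u"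
    using F_diff[OF \<Delta>(3,1)] by (simp add: blinfun.diff_left diff_eq_eq)
  then have "norm (G (F (a (Suc k)))) \<le> \<beta> * \<omega> \<eta> d * norm ?u"
    using G_dd_diff_bound \<Delta> inc d(1) by metis
  also have "\<dots> \<le> m * norm ?u" using d(2) by (intro mult_right_mono) auto
  finally show ?thesis .
qed

text \<open>
  The gap between \<open>b\<^sub>k\<close> and \<open>a\<^sub>k\<close> also shrinks geometrically, but only after the first step; initially it
  is \<open>s\<close>. Accordingly \<open>b\<^sub>0\<close> may lie outside the ball, and \<open>b\<^sub>k\<close> is compared with \<open>b\<^sub>0\<close>.
\<close>

definition controlled :: "nat \<Rightarrow> bool" where
  "controlled k \<longleftrightarrow> blinfun_invertible (dd (a k) (b k)) \<and> a k \<in> \<Delta> \<and> b k \<in> \<Delta> \<and>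
     norm (b k - b 0) \<le> s + \<rho> \<and>
     norm (a k - a 0) \<le> \<rho> * (1 - W ^ k) \<and>
     norm (a (Suc k) - a k) \<le> \<eta> * W ^ k \<and>
     norm (b k - a k) \<le> (if k = 0 then s else \<eta> * W ^ k)"

text \<open>
  The radii \<open>\<rho> (1 - W\<^sup>k)\<close> are the partial sums of the series \<open>\<eta> + \<eta> W + \<eta> W\<^sup>2 + \<dots>\<close>.
\<close>

lemma partial_sum_step: "\<rho> * (1 - W ^ k) + \<eta> * W ^ k = \<rho> * (1 - W ^ Suc k)"
  unfolding \<rho>W[symmetric] by (simp add: algebra_simps)

lemma partial_sum_le: "\<rho> * (1 - W ^ k) \<le> \<rho>"
  using \<rho> W_nonneg by (simp add: algebra_simps)

lemma power_W_le: "\<eta> * W ^ k \<le> \<eta>"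
  using \<eta> W_nonneg W1 by (simp add: mult_left_le power_le_one)

lemma norm_step_triangle:
  "norm (x - y) \<le> c \<Longrightarrow> norm (y - z) \<le> d \<Longrightarrow> norm (x - z) \<le> d + c" for x y z :: 'a
  using norm_triangle_ineq[of "x - y" "y - z"] by simp

lemma controlled_0: "controlled 0"
proof -
  have "blinfun_invertible (dd (a 0) (b 0))" using G unfolding blinfun_invertible_def by blast
  moreover from this have "blinfun_inv (dd (a 0) (b 0)) = G"
    using G is_blinfun_inverse_blinfun_inv is_blinfun_inverse_unique by blast
  ultimately show ?thesis
    unfolding controlled_def using a0 b0 A1 A3 step_a[of 0] s_nonneg \<rho>
    by (simp add: norm_minus_commute)
qed

lemma controlled_residual:
  assumes "controlled k"
  shows "norm (a (Suc k) - a 0) \<le> \<rho> * (1 - W ^ Suc k)"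
    and "norm (G (F (a (Suc k)))) \<le> m * (\<eta> * W ^ k)"
proof -
  show dist: "norm (a (Suc k) - a 0) \<le> \<rho> * (1 - W ^ Suc k)"
    using assms norm_step_triangle[of "a (Suc k)" "a k" _ "a 0"] partial_sum_step[of k]
    unfolding controlled_def by metis
  have "a (Suc k) \<in> \<Delta>" using dist partial_sum_le in_\<Delta> order_trans by blast
  moreover have "norm (b k - a k) \<le> s \<or> norm (b k - a k) \<le> \<eta>"
    using assms power_W_le[of k] unfolding controlled_def by (auto split: if_splits)
  moreover have "norm (a (Suc k) - a k) \<le> \<eta>"
    using assms power_W_le[of k] unfolding controlled_def by linarith
  ultimately have "norm (G (F (a (Suc k)))) \<le> m * norm (a (Suc k) - a k)"
    using assms residual_bound unfolding controlled_def by blast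
  also have "\<dots> \<le> m * (\<eta> * W ^ k)"
    using assms m_nonneg unfolding controlled_def by (intro mult_left_mono) auto
  finally show "norm (G (F (a (Suc k)))) \<le> m * (\<eta> * W ^ k)" .
qed

text \<open>
  Up to sign, \<open>b\<^bsub>k+1\<^esub> - a\<^bsub>k+1\<^esub>\<close> and \<open>a\<^bsub>k+2\<^esub> - a\<^bsub>k+1\<^esub>\<close> are the images of the same residual \<open>F a\<^bsub>k+1\<^esub>\<close>
  under the inverses of \<open>\<Upsilon>\<^sub>k\<close> and \<open>\<Upsilon>\<^bsub>k+1\<^esub>\<close>. A bound for every operator \<open>T\<close> near \<open>\<Upsilon>\<^sub>0\<close> serves both.
\<close>

lemma controlled_correction:
  fixes T :: "'a \<Rightarrow>\<^sub>L 'b"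
  assumes "controlled k" and near: "\<And>x. norm (G (T x) - x) \<le> g * norm x"
    and "blinfun_invertible T"
  shows "norm (blinfun_inv T (F (a (Suc k)))) \<le> \<eta> * W ^ Suc k"
proof -
  have "(1 - g) * norm (blinfun_inv T (F (a (Suc k)))) \<le> norm (G (F (a (Suc k))))"
    using assms by (intro near_inverse_inverse_bound)
  also have "\<dots> \<le> m * (\<eta> * W ^ k)" by (rule controlled_residual(2)[OF assms(1)])
  also have "\<dots> = (1 - g) * (\<eta> * W ^ Suc k)" unfolding gW[symmetric] by simp
  finally show ?thesis using g1 by simp
qed

lemma controlled_Suc:
  assumes k: "controlled k"
  shows "controlled (Suc k)"
proof -
  let ?T = "dd (a (Suc k)) (b (Suc k))"
  have near_k: "norm (G (dd (a k) (b k) x) - x) \<le> g * norm x" for x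
    using k partial_sum_le[of k] order_trans unfolding controlled_def
    by (blast intro!: dd_near_inverse)
  have gap: "norm (b (Suc k) - a (Suc k)) \<le> \<eta> * W ^ Suc k"
    using controlled_correction[OF k near_k] k unfolding controlled_def by (simp add: step_b)
  have dist_a: "norm (a (Suc k) - a 0) \<le> \<rho> * (1 - W ^ Suc k)"
    by (rule controlled_residual(1)[OF k])
  then have a_le: "norm (a (Suc k) - a 0) \<le> \<rho>" using partial_sum_le order_trans by blast
  have "norm (b (Suc k) - a 0) \<le> \<rho> * (1 - W ^ Suc (Suc k))"
    using norm_step_triangle[OF gap dist_a] partial_sum_step by metis
  then have b_le: "norm (b (Suc k) - a 0) \<le> \<rho>" using partial_sum_le order_trans by blast
  have near: "norm (G (?T x) - x) \<le> g * norm x" for x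
    by (intro dd_near_inverse in_\<Delta> near_b0 a_le b_le)
  have inv: "blinfun_invertible ?T"
    using near_inverse_invertible[OF G_inj near g_nonneg g1] .
  have "norm (a (Suc (Suc k)) - a (Suc k)) \<le> \<eta> * W ^ Suc k"
    using controlled_correction[OF k near inv] by (simp add: step_a[of "Suc k"])
  then show ?thesis
    unfolding controlled_def using inv in_\<Delta>[OF a_le] in_\<Delta>[OF b_le] near_b0[OF b_le] dist_a gap
    by simp
qed

lemma iterate_bounds: "controlled k"
  by (induction k) (auto intro: controlled_0 controlled_Suc)

lemma dist_a_le: "norm (a k - a 0) \<le> \<rho>"
  using iterate_bounds[of k] partial_sum_le[of k] unfolding controlled_def by linarith

lemma powers_tendsto_0: "(\<lambda>k. c * W ^ k) \<longlonglongrightarrow> 0" for c :: real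
  using LIMSEQ_power_zero[of W] W_nonneg W1 by (intro tendsto_mult_right_zero) auto

lemma a_convergent: "convergent a"
proof -
  have "summable (\<lambda>k. \<eta> * W ^ k)"
    using W_nonneg W1 by (intro summable_mult summable_geometric) simp
  then have "summable (\<lambda>k. a (Suc k) - a k)"
    by (rule summable_comparison_test'[where N = 0])
      (use iterate_bounds controlled_def in auto)
  then have "convergent (\<lambda>n. \<Sum>k<n. a (Suc k) - a k)" by (simp add: summable_iff_convergent)
  then have "convergent (\<lambda>n. a n - a 0)" by (simp add: sum_lessThan_telescope)
  then show ?thesis using convergent_add[OF _ convergent_const[of "a 0"]] by fastforce
qed

lemma b_minus_a_tendsto_0: "(\<lambda>k. b k - a k) \<longlonglongrightarrow> 0"
proof (rule Lim_null_comparison[OF _ powers_tendsto_0[of \<eta>]])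
  show "\<forall>\<^sub>F k in sequentially. norm (b k - a k) \<le> \<eta> * W ^ k"
    using iterate_bounds unfolding controlled_def
    by (intro eventually_sequentiallyI[of 1]) (metis not_one_le_zero)
qed

lemma limit_in_cball:
  assumes "a \<longlonglongrightarrow> z"
  shows "norm (z - a 0) \<le> \<rho>"
  by (rule tendsto_upperbound[OF tendsto_norm[OF tendsto_diff[OF assms tendsto_const]]])
    (auto simp: dist_a_le)

lemma limit_is_zero:
  assumes lim: "a \<longlonglongrightarrow> z"
  shows "F z = 0"
proof -
  have "(\<lambda>k. F (a k)) \<longlonglongrightarrow> F z"
    using F_cont lim in_\<Delta>[OF limit_in_cball[OF lim]] in_\<Delta>[OF dist_a_le]
    by (intro continuous_on_tendsto_compose[OF F_cont lim]) auto
  then have "(\<lambda>k. G (F (a (Suc k)))) \<longlonglongrightarrow> G (F z)"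
    by (intro blinfun.tendsto tendsto_const LIMSEQ_Suc)
  moreover have "(\<lambda>k. G (F (a (Suc k)))) \<longlonglongrightarrow> 0"
    by (rule Lim_null_comparison[OF _ powers_tendsto_0[of "m * \<eta>"]])
      (use controlled_residual(2)[OF iterate_bounds] in \<open>auto simp: mult.assoc\<close>)
  ultimately have "G (F z) = 0" using LIMSEQ_unique by blast
  then show ?thesis by (rule G_inj)
qed

lemma zero_unique:
  assumes "norm (x - a 0) \<le> \<rho>" "norm (z - a 0) \<le> \<rho>" "F x = 0" "F z = 0"
  shows "x = z"
proof -
  have "(1 - g) * norm (x - z) \<le> 0" using expanding[of x z] assms by simp
  then show ?thesis using g1 by (simp add: mult_le_0_iff)
qed

text \<open>
  The geometric series is crude from the second term on: expansion bounds the whole remaining distance from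
  \<open>a\<^sub>1\<close> to the zero by \<open>\<eta> W\<close>, against \<open>\<eta> W / (1 - W)\<close> for the sum of the increments.
\<close>

lemma zero_in_open_ball:
  assumes z: "norm (z - a 0) \<le> \<rho>" "F z = 0" and "m \<noteq> 0"
  shows "norm (z - a 0) < \<rho>"
proof -
  have "W \<noteq> 0" using gW \<open>m \<noteq> 0\<close> by auto
  have "(1 - g) * norm (z - a 1) \<le> norm (G (F (a 1)))"
    using expanding[OF z(1) dist_a_le[of 1]] z(2) by (simp add: blinfun.zero_right)
  also have "\<dots> \<le> (1 - g) * (\<eta> * W)"
    using controlled_residual(2)[OF iterate_bounds[of 0]] unfolding gW[symmetric] by (simp add: mult_ac)
  finally have "norm (z - a 1) \<le> \<eta> * W" using g1 by simp
  moreover have "norm (a 1 - a 0) \<le> \<eta>"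
    using iterate_bounds[of 0] unfolding controlled_def by simp
  ultimately have "norm (z - a 0) \<le> \<eta> + \<eta> * W" by (rule norm_step_triangle)
  also have "\<dots> = \<rho> - \<rho> * W\<^sup>2" unfolding \<rho>W[symmetric] by (simp add: algebra_simps power2_eq_square)
  also have "\<dots> < \<rho>" using \<rho> \<open>W \<noteq> 0\<close> by simp
  finally show ?thesis .
qed

lemma m_nonzero:
  assumes "convex \<Delta>" "nonlinear_on \<Delta> F"
  shows "m \<noteq> 0"
proof
  assume "m = 0"
  then have "\<omega> \<eta> \<eta> = 0"
    using m_\<eta> \<beta> \<eta> \<omega>_nonneg[of \<eta> \<eta>] by (simp add: mult_le_0_iff)
  have "dd p (a 0) = dd u (a 0)" if "p \<in> \<Delta>" "u \<in> \<Delta>" "norm (p - u) \<le> \<eta>" for p u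
  proof -
    have "norm (dd p (a 0) - dd u (a 0)) \<le> \<omega> (norm (p - u)) 0"
      using A4[of p "a 0" u "a 0"] that a0 by simp
    also have "\<dots> \<le> \<omega> \<eta> \<eta>" using that \<eta> by (intro \<omega>_mono) auto
    finally show ?thesis using \<open>\<omega> \<eta> \<eta> = 0\<close> by simp
  qed
  then have "\<not> nonlinear_on \<Delta> F"
    using rigid_divided_difference_not_nonlinear[OF assms(1) \<eta> dd a0] by blast
  with assms(2) show False by blast
qed

end

theorem theorem2p1:
  fixes \<Delta> :: "'a::banach set"
    and F :: "'a \<Rightarrow> 'b::banach"
    and dd :: "'a \<Rightarrow> 'a \<Rightarrow> ('a \<Rightarrow>\<^sub>L 'b)"
    and a b :: "nat \<Rightarrow> 'a"
    and \<Upsilon> :: "nat \<Rightarrow> ('a \<Rightarrow>\<^sub>L 'b)"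
    and s \<beta> \<eta> m \<rho> W :: real
    and \<omega> :: "real \<Rightarrow> real \<Rightarrow> real"
  assumes "\<Delta> \<noteq> {}" and "open \<Delta>" and "convex \<Delta>"
    and "continuous_on \<Delta> F" and "nonlinear_on \<Delta> F"
    and "divided_difference_on \<Delta> F dd"
    and "a 0 \<in> \<Delta>" and "b 0 \<in> \<Delta>"
    and \<Upsilon>: "\<And>k. \<Upsilon> k = dd (a k) (b k)"
    and "blinfun_invertible (\<Upsilon> 0)"
    and "s > 0" and "\<beta> > 0" and "\<eta> > 0"
    and \<omega>_nonneg: "\<And>x y. x \<ge> 0 \<Longrightarrow> y \<ge> 0 \<Longrightarrow> \<omega> x y \<ge> 0"
    and \<omega>_cont: "continuous_on ({0..} \<times> {0..}) (\<lambda>(x, y). \<omega> x y)"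
    and \<omega>_mono1: "\<And>y. y \<ge> 0 \<Longrightarrow> mono_on {0..} (\<lambda>x. \<omega> x y)"
    and \<omega>_mono2: "\<And>x. x \<ge> 0 \<Longrightarrow> mono_on {0..} (\<lambda>y. \<omega> x y)"
    and A1: "norm (a 0 - b 0) \<le> s"
    and A2: "norm (blinfun_inv (\<Upsilon> 0)) \<le> \<beta>"
    and A3: "norm (blinfun_apply (blinfun_inv (\<Upsilon> 0)) (F (a 0))) \<le> \<eta>"
    and A4: "\<And>p q u v. p \<in> \<Delta> \<Longrightarrow> q \<in> \<Delta> \<Longrightarrow> u \<in> \<Delta> \<Longrightarrow> v \<in> \<Delta> \<Longrightarrow>
               norm (dd p q - dd u v) \<le> \<omega> (norm (p - u)) (norm (q - v))"
    and m: "m = max (\<beta> * \<omega> \<eta> s) (\<beta> * \<omega> \<eta> \<eta>)"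
    and \<rho>_root: "positive_root \<omega> \<beta> \<eta> s m \<rho>"
    and \<rho>_least: "\<And>\<mu>. positive_root \<omega> \<beta> \<eta> s m \<mu> \<Longrightarrow> \<rho> \<le> \<mu>"
    and "\<beta> * \<omega> \<rho> (s + 3 * \<rho>) < 1"
    and W: "W = m / (1 - \<beta> * \<omega> \<rho> (s + 3 * \<rho>))" and "W < 1"
    and "closure (ball (a 0) \<rho>) \<subseteq> \<Delta>"
    and step_a: "\<And>k. a (Suc k) = a k - blinfun_apply (blinfun_inv (\<Upsilon> k)) (F (a k))"
    and step_b: "\<And>k. b (Suc k) = a (Suc k) - blinfun_apply (blinfun_inv (\<Upsilon> k)) (F (a (Suc k)))"
  shows "(\<forall>k. a k \<in> \<Delta> \<and> b k \<in> \<Delta> \<and> blinfun_invertible (\<Upsilon> k)) \<and>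
    (\<exists>a_star. a \<longlonglongrightarrow> a_star \<and> b \<longlonglongrightarrow> a_star \<and>
       F a_star = 0 \<and> a_star \<in> ball (a 0) \<rho> \<and>
       (\<forall>x \<in> closure (ball (a 0) \<rho>). F x = 0 \<longrightarrow> x = a_star))"
proof -
  define g where "g = \<beta> * \<omega> \<rho> (s + 3 * \<rho>)"
  have "\<rho> > 0" and root: "\<rho> * (1 - W) = \<eta>"
    using \<rho>_root W unfolding positive_root_def by auto
  have \<omega>_mono: "\<omega> x y \<le> \<omega> x' y'" if "0 \<le> x" "x \<le> x'" "0 \<le> y" "y \<le> y'" for x x' y y'
  proof -
    have "\<omega> x y \<le> \<omega> x' y" using mono_onD[OF \<omega>_mono1[of y], of x x'] that by simp
    also have "\<dots> \<le> \<omega> x' y'" using mono_onD[OF \<omega>_mono2[of x'], of y y'] that by simp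
    finally show ?thesis .
  qed
  have closure: "closure (ball (a 0) \<rho>) = cball (a 0) \<rho>"
    using \<open>\<rho> > 0\<close> by (rule closure_ball)
  interpret secant_iteration \<Delta> F dd "blinfun_inv (\<Upsilon> 0)" a b s \<beta> \<eta> m g \<rho> W \<omega>
  proof
    show "is_blinfun_inverse (dd (a 0) (b 0)) (blinfun_inv (\<Upsilon> 0))"
      using \<open>blinfun_invertible (\<Upsilon> 0)\<close> \<Upsilon> is_blinfun_inverse_blinfun_inv by metis
    have "\<omega> \<rho> (s + \<rho>) \<le> \<omega> \<rho> (s + 3 * \<rho>)" using \<open>\<rho> > 0\<close> \<open>s > 0\<close> by (intro \<omega>_mono) auto
    then show "\<beta> * \<omega> \<rho> (s + \<rho>) \<le> g" unfolding g_def using \<open>\<beta> > 0\<close> by simp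
    show "g < 1" "(1 - g) * W = m"
      using \<open>\<beta> * \<omega> \<rho> (s + 3 * \<rho>) < 1\<close> W unfolding g_def by auto
    show "cball (a 0) \<rho> \<subseteq> \<Delta>" using \<open>closure (ball (a 0) \<rho>) \<subseteq> \<Delta>\<close> closure by simp
    show "a (Suc k) = a k - blinfun_inv (dd (a k) (b k)) (F (a k))" for k
      using step_a \<Upsilon> by simp
    show "b (Suc k) = a (Suc k) - blinfun_inv (dd (a k) (b k)) (F (a (Suc k)))" for k
      using step_b \<Upsilon> by simp
  qed (use assms \<omega>_mono root \<open>\<rho> > 0\<close> in auto)
  obtain z where lim: "a \<longlonglongrightarrow> z" using a_convergent unfolding convergent_def by blast
  note z = limit_in_cball[OF lim] limit_is_zero[OF lim]
  have "b \<longlonglongrightarrow> z" using tendsto_add[OF b_minus_a_tendsto_0 lim] by simp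
  moreover have "z \<in> ball (a 0) \<rho>"
    using zero_in_open_ball[OF z m_nonzero] \<open>convex \<Delta>\<close> \<open>nonlinear_on \<Delta> F\<close>
    by (simp add: dist_norm norm_minus_commute)
  moreover have "x = z" if "x \<in> closure (ball (a 0) \<rho>)" "F x = 0" for x
    using zero_unique[of x z] z that unfolding closure by (simp add: dist_norm norm_minus_commute)
  ultimately show ?thesis
    using lim z(2) iterate_bounds \<Upsilon> unfolding controlled_def by auto
qed

end
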